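(* For all problem data and every multiplier vector $\mu$ as described in the context, the time-block formulation $F_{\mathrm{tb}}$ admits an optimal solution $(y^*,\lambda^* )\in\tilde P^{y\text{-}\lambda}$. Moreover, such an optimal solution $(y^*,\lambda^* )$ can be mapped to a point $(y^*,s^* )\in\tilde P^{y\text{-}s}$ with the same switching vector $y^*$ that is optimal for the formulation $F_{\mathrm r}$; that is, for any optimal solution $(y^*,\lambda^* )$ of $F_{\mathrm{tb}}$ there exists $s^*$ such that $(y^*,s^* )\in\tilde P^{y\text{-}s}$ and $(y^*,s^* )$ is an optimal solution of $F_{\mathrm r}$.
   Context: Data. $\mathcal N=\{1,\dots,N\}$ is the set of charging ports; $\mathcal T=\{1,\dots,T\}$ the set of time periods; $\mathcal L=\{1,\dots,L\}$ the set of demand windows; $\mathcal B$ is a finite set of batteries partitioned into pairwise disjoint sets $\mathcal B_\ell$, $\ell\in\mathcal L$. For $\ell\in\mathcal L$, $n_\ell\in\mathcal T$ and $\mathcal T_\ell=\{1,\dots,n_\ell\}$, with $n_L=T$. Further data: prices $c_t\ge 0$ ($t\in\mathcal T$), $\gamma\in\mathbb Z_+$, $w\ge 0$, $\beta\in(0,1)$, and real multipliers $\mu_{jkt}$ for $\ell\in\mathcal L$, $j\in\mathcal B_\ell$, $k\in\mathcal N$, $t\in\mathcal T_\ell$. Put $\bar c_{jkt}:=(1-\beta)c_t-\mu_{jkt}$. Variables. $s_{jkt}$ is indexed by $\ell\in\mathcal L$, $j\in\mathcal B_\ell$, $k\in\mathcal N$, $t\in\mathcal T_\ell$; for $j\in\mathcal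 B_\ell$ and $t>n_\ell$ set $s_{jkt}:=0$. $y_{kt}$ is indexed by $k\in\mathcal N$, $t\in\mathcal T\setminus\{T\}$. Formulation $F_{\mathrm r}$. $\tilde P^{y\text{-}s}$ is the set of binary $(y,s)$ (all $y_{kt},s_{jkt}\in\{0,1\}$) such that (i) $y_{kt}\ge\sum_{j\in\mathcal B}s_{jk,t+1}-\sum_{j\in\mathcal B}s_{jkt}$ for $k\in\mathcal N$, $t\in\mathcal T\setminus\{T\}$; (ii) $y_{kt}\ge s_{jkt}-s_{jk,t+1}$ for $\ell\in\mathcal L$, $j\in\mathcal B_\ell$, $k\in\mathcal N$, $t\in\mathcal T_\ell\setminus\{T\}$; (iii) $\sum_{k\in\mathcal N}y_{kt}\le\gamma$ for $t\in\mathcal T\setminus\{T\}$; (iv) $\sum_{j\in\mathcal B}s_{jkt}\le 1$ for $k\in\mathcal N$, $t\in\mathcal T$. $F_{\mathrm r}$ is the problem of minimizing $\sum_{\ell\in\mathcal L}\sum_{t\in\mathcal T_\ell}\sum_{j\in\mathcal B_\ell}\sum_{k\in\mathcal N}\bar c_{jkt}s_{jkt}+w\sum_{k\in\mathcal N}\sum_{t\in\mathcal T\setminus\{T\}}y_{kt}$ over $(y,s)\in\tilde P^{y\text{-}s}$. Formulation $F_{\mathrm{tb}}$. A time block is a pair $(t_1,t_2)$ of integers with $0\le t_1<t_2\le T$. For $k\in\mathcal N$ and a time block $(t_1,t_2)$ let $d^k_{t_1t_2}:=\min\{\sum_{t=t_1+1}^{t_2}\bar c_{jkt}\mid \ell\in\mathcal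 L,\ j\in\mathcal B_\ell,\ t_2\le n_\ell\}$ (with $\min\emptyset=+\infty$), and let $\mathcal T^k_<$ be the set of time blocks with $d^k_{t_1t_2}<0$. The variables are $y_{kt}\in\{0,1\}$ ($k\in\mathcal N$, $t\in\mathcal T\setminus\{T\}$) and $\lambda_{kt_1t_2}\in\{0,1\}$ ($k\in\mathcal N$, $(t_1,t_2)\in\mathcal T^k_<$). $\tilde P^{y\text{-}\lambda}$ is the set of binary $(y,\lambda)$ such that (a) $\lambda_{kt_1t_2}+\lambda_{kt_1't_2'}\le 1$ for $k\in\mathcal N$ and distinct $(t_1,t_2),(t_1',t_2')\in\mathcal T^k_<$ with $t_1'<t_2$ and $t_2'>t_1$; (b) $y_{kt_1}\ge\sum_{t=t_1+1}^{T}\lambda_{kt_1t}$ for $k\in\mathcal N$, $t_1\in\{1,\dots,T-1\}$; (c) $y_{kt_2}\ge\sum_{t=0}^{t_2-1}\lambda_{ktt_2}$ for $k\in\mathcal N$, $t_2\in\{1,\dots,T-1\}$; (d) $\sum_{k\in\mathcal N}y_{kt}\le\gamma$ for $t\in\mathcal T\setminus\{T\}$; where in (b), (c) only those $\lambda$ whose block lies in $\mathcal T^k_<$ appear in the sums. $F_{\mathrm{tb}}$ is the problem of minimizing $\sum_{k\in\mathcal N}\sum_{(t_1,t_2)\in\mathcal T^k_<}d^k_{t_1t_2}\lambda_{kt_1t_2}+w\sum_{k\in\mathcal N}\sum_{t\in\mathcal T\setminus\{T\}}y_{kt}$ over $(y,\lambda)\in\tilde P^{y\text{-}\lambda}$.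 *)

theory Defs
  imports Complex_Main "HOL-Library.Extended_Real"
begin

text \<open>Ports, periods and demand windows are the initial segments \<open>{1..num_ports}\<close>,
  \<open>{1..horizon}\<close>, \<open>{1..num_windows}\<close>; \<open>window_batteries D l\<close> is the block of the battery
  partition belonging to window \<open>l\<close>, and \<open>window_end D l\<close> is its last admissible period
  \<open>n\<^sub>l\<close>.\<close>

record 'b charging_data =
  num_ports :: nat
  horizon :: nat
  num_windows :: nat
  window_batteries :: "nat \<Rightarrow> 'b set"
  window_end :: "nat \<Rightarrow> nat"
  price :: "nat \<Rightarrow> real"
  switch_limit :: nat
  switch_weight :: real
  beta :: real

definition ports :: "'b charging_data \<Rightarrow> nat set" where
  "ports D = {1..num_ports D}"

definition periods :: "'b charging_data \<Rightarrow> nat set" where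
  "periods D = {1..horizon D}"

definition windows :: "'b charging_data \<Rightarrow> nat set" where
  "windows D = {1..num_windows D}"

definition window_periods :: "'b charging_data \<Rightarrow> nat \<Rightarrow> nat set" where
  "window_periods D l = {1..window_end D l}"

definition batteries :: "'b charging_data \<Rightarrow> 'b set" where
  "batteries D = (\<Union>l\<in>windows D. window_batteries D l)"

definition valid_data :: "'b charging_data \<Rightarrow> bool" where
  "valid_data D \<longleftrightarrow>
     finite (batteries D) \<and>
     (\<forall>l\<in>windows D. \<forall>l'\<in>windows D. l \<noteq> l' \<longrightarrow> window_batteries D l \<inter> window_batteries D l' = {}) \<and>
     (\<forall>l\<in>windows D. window_end D l \<in> periods D) \<and>
     num_windows D \<in> windows D \<and> window_end D (num_windows D) = horizon D \<and>
     (\<forall>t\<in>periods D. 0 \<le> price D t) \<and>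
     0 \<le> switch_weight D \<and>
     0 < beta D \<and> beta D < 1"

text \<open>A multiplier vector is a function \<open>mu j k t\<close>; the window of \<open>j\<close> is determined by \<open>j\<close>, and
  values outside the index range \<open>j \<in> window_batteries D l\<close>, \<open>k \<in> ports D\<close>,
  \<open>t \<in> window_periods D l\<close> are never used.\<close>

definition cbar :: "'b charging_data \<Rightarrow> ('b \<Rightarrow> nat \<Rightarrow> nat \<Rightarrow> real) \<Rightarrow> 'b \<Rightarrow> nat \<Rightarrow> nat \<Rightarrow> real" where
  "cbar D mu j k t = (1 - beta D) * price D t - mu j k t"

text \<open>Decision vectors are total functions that are binary on their index set and vanish off it.
  For \<open>s\<close> this contains the convention \<open>s j k t = 0\<close> for periods beyond the window of \<open>j\<close>.\<close>

definition binary_y :: "'b charging_data \<Rightarrow> (nat \<Rightarrow> nat \<Rightarrow> real) \<Rightarrow> bool" where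
  "binary_y D y \<longleftrightarrow>
     (\<forall>k t. if k \<in> ports D \<and> t \<in> periods D - {horizon D} then y k t \<in> {0, 1} else y k t = 0)"

definition binary_s :: "'b charging_data \<Rightarrow> ('b \<Rightarrow> nat \<Rightarrow> nat \<Rightarrow> real) \<Rightarrow> bool" where
  "binary_s D s \<longleftrightarrow>
     (\<forall>j k t. if \<exists>l\<in>windows D. j \<in> window_batteries D l \<and> k \<in> ports D \<and> t \<in> window_periods D l
              then s j k t \<in> {0, 1} else s j k t = 0)"

definition P_ys :: "'b charging_data \<Rightarrow> ((nat \<Rightarrow> nat \<Rightarrow> real) \<times> ('b \<Rightarrow> nat \<Rightarrow> nat \<Rightarrow> real)) set" where
  "P_ys D = {(y, s). binary_y D y \<and> binary_s D s \<and>
     (\<forall>k\<in>ports D. \<forall>t\<in>periods D - {horizon D}.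
        y k t \<ge> (\<Sum>j\<in>batteries D. s j k (t + 1)) - (\<Sum>j\<in>batteries D. s j k t)) \<and>
     (\<forall>l\<in>windows D. \<forall>j\<in>window_batteries D l. \<forall>k\<in>ports D. \<forall>t\<in>window_periods D l - {horizon D}.
        y k t \<ge> s j k t - s j k (t + 1)) \<and>
     (\<forall>t\<in>periods D - {horizon D}. (\<Sum>k\<in>ports D. y k t) \<le> real (switch_limit D)) \<and>
     (\<forall>k\<in>ports D. \<forall>t\<in>periods D. (\<Sum>j\<in>batteries D. s j k t) \<le> 1)}"

definition switch_cost :: "'b charging_data \<Rightarrow> (nat \<Rightarrow> nat \<Rightarrow> real) \<Rightarrow> real" where
  "switch_cost D y = switch_weight D * (\<Sum>k\<in>ports D. \<Sum>t\<in>periods D - {horizon D}. y k t)"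

definition obj_r :: "'b charging_data \<Rightarrow> ('b \<Rightarrow> nat \<Rightarrow> nat \<Rightarrow> real) \<Rightarrow>
    (nat \<Rightarrow> nat \<Rightarrow> real) \<times> ('b \<Rightarrow> nat \<Rightarrow> nat \<Rightarrow> real) \<Rightarrow> real" where
  "obj_r D mu = (\<lambda>(y, s).
     (\<Sum>l\<in>windows D. \<Sum>t\<in>window_periods D l. \<Sum>j\<in>window_batteries D l. \<Sum>k\<in>ports D.
        cbar D mu j k t * s j k t) + switch_cost D y)"

definition optimal_r :: "'b charging_data \<Rightarrow> ('b \<Rightarrow> nat \<Rightarrow> nat \<Rightarrow> real) \<Rightarrow>
    (nat \<Rightarrow> nat \<Rightarrow> real) \<times> ('b \<Rightarrow> nat \<Rightarrow> nat \<Rightarrow> real) \<Rightarrow> bool" where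
  "optimal_r D mu = is_arg_min (obj_r D mu) (\<lambda>x. x \<in> P_ys D)"

definition time_blocks :: "'b charging_data \<Rightarrow> (nat \<times> nat) set" where
  "time_blocks D = {(t1, t2). t1 < t2 \<and> t2 \<le> horizon D}"

definition block_costs :: "'b charging_data \<Rightarrow> ('b \<Rightarrow> nat \<Rightarrow> nat \<Rightarrow> real) \<Rightarrow> nat \<Rightarrow> nat \<times> nat \<Rightarrow> real set" where
  "block_costs D mu k = (\<lambda>(t1, t2).
     {\<Sum>t = t1 + 1..t2. cbar D mu j k t | l j.
        l \<in> windows D \<and> j \<in> window_batteries D l \<and> t2 \<le> window_end D l})"

definition d_block :: "'b charging_data \<Rightarrow> ('b \<Rightarrow> nat \<Rightarrow> nat \<Rightarrow> real) \<Rightarrow> nat \<Rightarrow> nat \<times> nat \<Rightarrow> ereal" where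
  "d_block D mu k b =
     (if block_costs D mu k b = {} then \<infinity> else ereal (Min (block_costs D mu k b)))"

definition neg_blocks :: "'b charging_data \<Rightarrow> ('b \<Rightarrow> nat \<Rightarrow> nat \<Rightarrow> real) \<Rightarrow> nat \<Rightarrow> (nat \<times> nat) set" where
  "neg_blocks D mu k = {b \<in> time_blocks D. d_block D mu k b < 0}"

definition binary_lam :: "'b charging_data \<Rightarrow> ('b \<Rightarrow> nat \<Rightarrow> nat \<Rightarrow> real) \<Rightarrow>
    (nat \<Rightarrow> nat \<times> nat \<Rightarrow> real) \<Rightarrow> bool" where
  "binary_lam D mu lam \<longleftrightarrow>
     (\<forall>k b. if k \<in> ports D \<and> b \<in> neg_blocks D mu k then lam k b \<in> {0, 1} else lam k b = 0)"

definition P_ylam :: "'b charging_data \<Rightarrow> ('b \<Rightarrow> nat \<Rightarrow> nat \<Rightarrow> real) \<Rightarrow>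
    ((nat \<Rightarrow> nat \<Rightarrow> real) \<times> (nat \<Rightarrow> nat \<times> nat \<Rightarrow> real)) set" where
  "P_ylam D mu = {(y, lam). binary_y D y \<and> binary_lam D mu lam \<and>
     (\<forall>k\<in>ports D. \<forall>(t1, t2)\<in>neg_blocks D mu k. \<forall>(t1', t2')\<in>neg_blocks D mu k.
        (t1, t2) \<noteq> (t1', t2') \<and> t1' < t2 \<and> t2' > t1 \<longrightarrow> lam k (t1, t2) + lam k (t1', t2') \<le> 1) \<and>
     (\<forall>k\<in>ports D. \<forall>t1\<in>{1..horizon D - 1}.
        y k t1 \<ge> (\<Sum>t | t \<in> {t1 + 1..horizon D} \<and> (t1, t) \<in> neg_blocks D mu k. lam k (t1, t))) \<and>
     (\<forall>k\<in>ports D. \<forall>t2\<in>{1..horizon D - 1}.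
        y k t2 \<ge> (\<Sum>t | t \<in> {0..t2 - 1} \<and> (t, t2) \<in> neg_blocks D mu k. lam k (t, t2))) \<and>
     (\<forall>t\<in>periods D - {horizon D}. (\<Sum>k\<in>ports D. y k t) \<le> real (switch_limit D))}"

text \<open>On \<open>neg_blocks\<close> the value of \<open>d_block\<close> is finite, so \<open>real_of_ereal\<close> loses nothing here.\<close>

definition obj_tb :: "'b charging_data \<Rightarrow> ('b \<Rightarrow> nat \<Rightarrow> nat \<Rightarrow> real) \<Rightarrow>
    (nat \<Rightarrow> nat \<Rightarrow> real) \<times> (nat \<Rightarrow> nat \<times> nat \<Rightarrow> real) \<Rightarrow> real" where
  "obj_tb D mu = (\<lambda>(y, lam).
     (\<Sum>k\<in>ports D. \<Sum>b\<in>neg_blocks D mu k. real_of_ereal (d_block D mu k b) * lam k b)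
     + switch_cost D y)"

definition optimal_tb :: "'b charging_data \<Rightarrow> ('b \<Rightarrow> nat \<Rightarrow> nat \<Rightarrow> real) \<Rightarrow>
    (nat \<Rightarrow> nat \<Rightarrow> real) \<times> (nat \<Rightarrow> nat \<times> nat \<Rightarrow> real) \<Rightarrow> bool" where
  "optimal_tb D mu = is_arg_min (obj_tb D mu) (\<lambda>x. x \<in> P_ylam D mu)"

end

theory Submission
  imports Defs
begin

text \<open>Both problems are compared for a fixed switching vector. From \<open>\<lambda>\<close> one builds a schedule of the
  same cost by giving every selected block a battery attaining its minimum. Conversely, a schedule
  splits at each port into maximal runs of a single battery; keeping only the runs on blocks of
  negative cost does not increase the objective. Since there are only finitely many binary
  \<open>(y, \<lambda>)\<close>, a minimizer exists, and these two maps transfer its optimality.\<close>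

text \<open>Two ones would already violate a pairwise bound, so at most one value is 1. This turns
  the pairwise conflict constraints on blocks into one bound for a whole clique of mutually
  conflicting blocks.\<close>

lemma sum_le_one_if_pairwise:
  fixes f :: "'a \<Rightarrow> real"
  assumes "finite A" and "\<And>a. a \<in> A \<Longrightarrow> f a \<in> {0, 1}"
    and "\<And>a b. a \<in> A \<Longrightarrow> b \<in> A \<Longrightarrow> a \<noteq> b \<Longrightarrow> f a + f b \<le> 1"
  shows "sum f A \<in> {0, 1}"
proof (cases "\<exists>a\<in>A. f a = 1")
  case True
  then obtain a where a: "a \<in> A" "f a = 1" by blast
  have "f b = 0" if "b \<in> A - {a}" for b
    using assms(2)[of b] assms(3)[of a b] a that by auto
  then have "sum f (A - {a}) = 0" by simp
  then show ?thesis
    using a assms(1) by (simp add: sum.remove)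
next
  case False
  then have "sum f A = 0"
    using assms(2) by (intro sum.neutral) blast
  then show ?thesis by simp
qed

subsection \<open>Maximal runs of a set of natural numbers\<close>

text \<open>A pair \<open>(a, b)\<close> stands for the periods \<open>a + 1\<close> to
  \<open>b\<close>, the convention of time blocks, so a run is directly a candidate block. The outer
  neighbours \<open>a\<close> and \<open>Suc b\<close> lie outside \<open>A\<close>, which makes the
  run maximal.\<close>

definition runs :: "nat set \<Rightarrow> (nat \<times> nat) set" where
  "runs A = {(a, b). a < b \<and> {a<..b} \<subseteq> A \<and> a \<notin> A \<and> Suc b \<notin> A}"

text \<open>If the end points differed, an outer neighbour of one run would fall inside the other
  run, hence into \<open>A\<close>.\<close>

lemma runs_overlap:
  assumes "(a, b) \<in> runs A" and "(c, d) \<in> runs A" and "c < b" and "a < d"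
  shows "(a, b) = (c, d)"
proof -
  have "\<not> a < c"
  proof
    assume "a < c"
    then have "c \<in> {a<..b}" using assms by auto
    then show False using assms unfolding runs_def by blast
  qed
  moreover have "\<not> c < a"
  proof
    assume "c < a"
    then have "a \<in> {c<..d}" using assms by auto
    then show False using assms unfolding runs_def by blast
  qed
  moreover have "\<not> b < d"
  proof
    assume "b < d"
    then have "Suc b \<in> {c<..d}" using assms by auto
    then show False using assms unfolding runs_def by blast
  qed
  moreover have "\<not> d < b"
  proof
    assume "d < b"
    then have "Suc d \<in> {a<..b}" using assms by auto
    then show False using assms unfolding runs_def by blast
  qed
  ultimately show ?thesis by auto
qed

text \<open>The run is bounded by the last non-member before \<open>t\<close>, which exists because
  0 is one, and the first non-member after \<open>t\<close>, which exists because \<open>A\<close>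
  is finite.\<close>

lemma ex_run:
  assumes "finite A" and "0 \<notin> A" and "t \<in> A"
  obtains a b where "(a, b) \<in> runs A" and "a < t" and "t \<le> b"
proof -
  define a where "a = Max {n. n < t \<and> n \<notin> A}"
  have "0 < t" using assms by (metis neq0_conv)
  then have "{n. n < t \<and> n \<notin> A} \<noteq> {}" using assms by auto
  moreover have fin: "finite {n. n < t \<and> n \<notin> A}" by auto
  ultimately have "a \<in> {n. n < t \<and> n \<notin> A}" unfolding a_def by (rule Max_in[rotated])
  then have a: "a < t" "a \<notin> A" by auto
  have left: "n \<in> A" if "a < n" "n < t" for n
    using that Max_ge[OF fin, of n] by (fold a_def) auto
  define c where "c = (LEAST n. t \<le> n \<and> n \<notin> A)"
  have "\<exists>n. t \<le> n \<and> n \<notin> A"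
    using assms(1) by (metis finite_nat_set_iff_bounded_le nat_le_linear not_less_eq_eq)
  then have c: "t \<le> c" "c \<notin> A" unfolding c_def by (metis (mono_tags, lifting) LeastI)+
  have right: "n \<in> A" if "t \<le> n" "n < c" for n
    using that not_less_Least[of n "\<lambda>n. t \<le> n \<and> n \<notin> A"] by (auto simp: c_def)
  have tc: "t < c" using c assms(3) by (metis le_neq_implies_less)
  have "n \<in> A" if "a < n" "n < c" for n
    using left right that by (meson not_le)
  then have "(a, c - 1) \<in> runs A" using a c tc by (auto simp: runs_def)
  then show ?thesis using that[of a "c - 1"] a tc by auto
qed

lemma finite_runs:
  assumes "finite A" shows "finite (runs A)"
proof -
  obtain m where m: "\<forall>n\<in>A. n \<le> m" using assms finite_nat_set_iff_bounded_le by auto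
  have "a < b" "b \<in> A" if "(a, b) \<in> runs A" for a b using that by (auto simp: runs_def)
  with m have "a \<le> m \<and> b \<le> m" if "(a, b) \<in> runs A" for a b
    using that by (meson less_imp_le_nat order_trans)
  then have "runs A \<subseteq> {..m} \<times> {..m}" by auto
  then show ?thesis by (rule finite_subset) auto
qed

text \<open>The runs partition \<open>A\<close>: they cover it by \<open>ex_run\<close> and are
  disjoint by \<open>runs_overlap\<close>. Hence the cost of a battery at a port splits into block
  costs.\<close>

lemma sum_runs:
  fixes f :: "nat \<Rightarrow> real"
  assumes "finite A" and "0 \<notin> A"
  shows "sum f A = (\<Sum>b\<in>runs A. \<Sum>t = fst b + 1..snd b. f t)"
proof -
  have "(\<Union>b\<in>runs A. {fst b + 1..snd b}) = A"
  proof
    show "(\<Union>b\<in>runs A. {fst b + 1..snd b}) \<subseteq> A" by (force simp: runs_def)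
    show "A \<subseteq> (\<Union>b\<in>runs A. {fst b + 1..snd b})"
    proof
      fix t assume "t \<in> A"
      then obtain a b where "(a, b) \<in> runs A" "a < t" "t \<le> b" using ex_run assms by metis
      then show "t \<in> (\<Union>b\<in>runs A. {fst b + 1..snd b})" by force
    qed
  qed
  moreover have "(\<Sum>t\<in>(\<Union>b\<in>runs A. {fst b + 1..snd b}). f t)
      = (\<Sum>b\<in>runs A. \<Sum>t = fst b + 1..snd b. f t)"
  proof (rule sum.UNION_disjoint)
    show "\<forall>p\<in>runs A. \<forall>q\<in>runs A. p \<noteq> q \<longrightarrow> {fst p + 1..snd p} \<inter> {fst q + 1..snd q} = {}"
    proof (intro ballI impI)
      fix p q assume pq: "p \<in> runs A" "q \<in> runs A" "p \<noteq> q"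
      then have "\<not> (fst q < snd p \<and> fst p < snd q)"
        using runs_overlap[of "fst p" "snd p" A "fst q" "snd q"] by auto
      then show "{fst p + 1..snd p} \<inter> {fst q + 1..snd q} = {}" by auto
    qed
  qed (use finite_runs[OF assms(1)] in auto)
  ultimately show ?thesis by simp
qed

subsection \<open>Time-block data\<close>

lemma finite_time_blocks: "finite (time_blocks D)"
proof -
  have "time_blocks D \<subseteq> {..horizon D} \<times> {..horizon D}" by (auto simp: time_blocks_def)
  then show ?thesis by (rule finite_subset) auto
qed

lemma finite_neg_blocks: "finite (neg_blocks D mu k)"
  using finite_time_blocks[of D] by (simp add: neg_blocks_def)

lemma finite_block_costs:
  assumes "valid_data D" shows "finite (block_costs D mu k b)"
proof -
  obtain t1 t2 where b: "b = (t1, t2)" by (cases b)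
  have "block_costs D mu k b \<subseteq> (\<lambda>j. \<Sum>t = t1 + 1..t2. cbar D mu j k t) ` batteries D"
    by (auto simp: b block_costs_def batteries_def)
  then show ?thesis using assms by (meson finite_imageI finite_subset valid_data_def)
qed

lemma d_block_le:
  assumes "valid_data D" and "l \<in> windows D" and "j \<in> window_batteries D l"
    and "t2 \<le> window_end D l"
  shows "d_block D mu k (t1, t2) \<le> ereal (\<Sum>t = t1 + 1..t2. cbar D mu j k t)"
proof -
  have "(\<Sum>t = t1 + 1..t2. cbar D mu j k t) \<in> block_costs D mu k (t1, t2)"
    using assms by (auto simp: block_costs_def)
  then show ?thesis
    using finite_block_costs[OF assms(1)] by (auto simp: d_block_def)
qed

text \<open>A negative block cost is not infinite, so the set of costs is nonempty; being finite as
  well, it attains its minimum.\<close>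

lemma ex_best_battery:
  assumes "valid_data D" and "b \<in> neg_blocks D mu k"
  shows "\<exists>j. (\<exists>l\<in>windows D. j \<in> window_batteries D l \<and> snd b \<le> window_end D l) \<and>
    real_of_ereal (d_block D mu k b) = (\<Sum>t = fst b + 1..snd b. cbar D mu j k t)"
proof -
  obtain t1 t2 where b: "b = (t1, t2)" by (cases b)
  have ne: "block_costs D mu k b \<noteq> {}"
    using assms(2) by (auto simp: neg_blocks_def d_block_def split: if_splits)
  then have "Min (block_costs D mu k b) \<in> block_costs D mu k b"
    using finite_block_costs[OF assms(1)] by (rule Min_in[rotated])
  then show ?thesis
    using ne by (auto simp: d_block_def b block_costs_def)
qed

text \<open>The share of one port in the linear cost. Summing over all periods instead of window
  periods is harmless for schedules that vanish after their windows.\<close>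

definition battery_cost where
  "battery_cost D mu s k = (\<Sum>j\<in>batteries D. \<Sum>t\<in>periods D. cbar D mu j k t * s j k t)"

text \<open>The windows partition the batteries, so the nested sums flatten and the objective
  separates by port, as \<open>obj_tb\<close> does.\<close>

lemma obj_r_eq:
  assumes "valid_data D" and "binary_s D s"
  shows "obj_r D mu (y, s) = (\<Sum>k\<in>ports D. battery_cost D mu s k) + switch_cost D y"
proof -
  define g where "g j = (\<Sum>t\<in>periods D. \<Sum>k\<in>ports D. cbar D mu j k t * s j k t)" for j
  have "(\<Sum>t\<in>window_periods D l. \<Sum>j\<in>window_batteries D l. \<Sum>k\<in>ports D.
      cbar D mu j k t * s j k t) = (\<Sum>j\<in>window_batteries D l. g j)" if l: "l \<in> windows D" for l
  proof -
    have sub: "window_periods D l \<subseteq> periods D"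
      using assms(1) l by (force simp: valid_data_def window_periods_def periods_def)
    \<comment> \<open>Disjointness leaves \<open>l\<close> as the only window containing
      \<open>j\<close>, so no other window can make the index admissible.\<close>
    have zero: "s j k t = 0" if "j \<in> window_batteries D l" "t \<notin> window_periods D l" for j k t
    proof -
      have "\<not> (\<exists>l'\<in>windows D. j \<in> window_batteries D l' \<and> k \<in> ports D \<and> t \<in> window_periods D l')"
        using assms(1) l that unfolding valid_data_def by (metis disjoint_iff)
      then show ?thesis using assms(2) unfolding binary_s_def by metis
    qed
    have "g j = (\<Sum>t\<in>window_periods D l. \<Sum>k\<in>ports D. cbar D mu j k t * s j k t)"
      if "j \<in> window_batteries D l" for j
      unfolding g_def
      by (rule sum.mono_neutral_right) (use sub zero that in \<open>auto simp: periods_def\<close>)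
    then show ?thesis by (subst sum.swap) simp
  qed
  then have "obj_r D mu (y, s) = (\<Sum>l\<in>windows D. \<Sum>j\<in>window_batteries D l. g j) + switch_cost D y"
    by (simp add: obj_r_def)
  also have "(\<Sum>l\<in>windows D. \<Sum>j\<in>window_batteries D l. g j) = (\<Sum>j\<in>batteries D. g j)"
  proof -
    have "finite (window_batteries D l)" if "l \<in> windows D" for l
      using assms(1) that unfolding valid_data_def batteries_def by (meson UN_upper finite_subset)
    then show ?thesis unfolding batteries_def
      by (intro sum.UNION_disjoint[symmetric])
        (use assms(1) in \<open>auto simp: valid_data_def windows_def\<close>)
  qed
  also have "\<dots> = (\<Sum>k\<in>ports D. battery_cost D mu s k)"
  proof -
    have "g j = (\<Sum>k\<in>ports D. \<Sum>t\<in>periods D. cbar D mu j k t * s j k t)" for j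
      unfolding g_def by (rule sum.swap)
    then show ?thesis unfolding battery_cost_def by (simp add: sum.swap[of _ "batteries D"])
  qed
  finally show ?thesis .
qed

text \<open>The range of the second end point is implied by membership in \<open>neg_blocks\<close>,
  so the sum may be indexed by blocks.\<close>

lemma neg_blocks_sum_fst:
  "(\<Sum>t | t \<in> {t1 + 1..horizon D} \<and> (t1, t) \<in> neg_blocks D mu k. f (t1, t))
    = (\<Sum>b | b \<in> neg_blocks D mu k \<and> fst b = t1. f b)"
  by (rule sum.reindex_bij_witness[where i = snd and j = "\<lambda>t. (t1, t)"])
    (auto simp: neg_blocks_def time_blocks_def)

lemma neg_blocks_sum_snd:
  "(\<Sum>t | t \<in> {0..t2 - 1} \<and> (t, t2) \<in> neg_blocks D mu k. f (t, t2))
    = (\<Sum>b | b \<in> neg_blocks D mu k \<and> snd b = t2. f b)"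
  by (rule sum.reindex_bij_witness[where i = fst and j = "\<lambda>t. (t, t2)"])
    (auto simp: neg_blocks_def time_blocks_def)

text \<open>Working form of feasibility: the start and stop constraints differ only in
  \<open>fst\<close> versus \<open>snd\<close>, which allows a common argument for both.\<close>

lemma P_ylam_iff:
  "(y, lam) \<in> P_ylam D mu \<longleftrightarrow> binary_y D y \<and> binary_lam D mu lam \<and>
     (\<forall>k\<in>ports D. \<forall>b\<in>neg_blocks D mu k. \<forall>c\<in>neg_blocks D mu k.
        b \<noteq> c \<and> fst c < snd b \<and> fst b < snd c \<longrightarrow> lam k b + lam k c \<le> 1) \<and>
     (\<forall>k\<in>ports D. \<forall>t\<in>periods D - {horizon D}.
        (\<Sum>b | b \<in> neg_blocks D mu k \<and> fst b = t. lam k b) \<le> y k t) \<and>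
     (\<forall>k\<in>ports D. \<forall>t\<in>periods D - {horizon D}.
        (\<Sum>b | b \<in> neg_blocks D mu k \<and> snd b = t. lam k b) \<le> y k t) \<and>
     (\<forall>t\<in>periods D - {horizon D}. (\<Sum>k\<in>ports D. y k t) \<le> real (switch_limit D))"
proof -
  have "{1..horizon D - 1} = periods D - {horizon D}" by (auto simp: periods_def)
  then show ?thesis
    unfolding P_ylam_def neg_blocks_sum_fst neg_blocks_sum_snd by (simp add: split_beta prod_eq_iff)
qed

subsection \<open>From time blocks to schedules\<close>

text \<open>The vector \<open>y\<close> already pays for the start and stop of every selected block,
  so filling blocks with batteries forces no further switch. A battery attaining the minimum makes
  each block contribute exactly its cost.\<close>

lemma schedule_of_blocks:
  assumes D: "valid_data D" and feas: "(y, lam) \<in> P_ylam D mu"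
  obtains s where "(y, s) \<in> P_ys D" and "obj_r D mu (y, s) = obj_tb D mu (y, lam)"
proof -
  let ?N = "neg_blocks D mu"
  define best where "best k b = (SOME j. (\<exists>l\<in>windows D. j \<in> window_batteries D l \<and> snd b \<le> window_end D l) \<and>
    real_of_ereal (d_block D mu k b) = (\<Sum>t = fst b + 1..snd b. cbar D mu j k t))" for k b
  have best: "\<exists>l\<in>windows D. best k b \<in> window_batteries D l \<and> snd b \<le> window_end D l"
      "real_of_ereal (d_block D mu k b) = (\<Sum>t = fst b + 1..snd b. cbar D mu (best k b) k t)"
    if "b \<in> ?N k" for k b
    using someI_ex[OF ex_best_battery[OF D that]] unfolding best_def[symmetric] by blast+
  have finB: "finite (batteries D)" using D by (simp add: valid_data_def)
  note finN = finite_neg_blocks[of D mu]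
  have lam01: "lam k b \<in> {0, 1}" for k b
    using feas unfolding P_ylam_iff binary_lam_def by (metis insertCI)
  have lam_port: "lam k b = 0" if "k \<notin> ports D" for k b
    using feas that unfolding P_ylam_iff binary_lam_def by metis
  have lam0: "0 \<le> lam k b" for k b using lam01[of k b] by auto
  have best_battery: "best k b \<in> batteries D" if "b \<in> ?N k" for k b
    using best(1)[OF that] by (auto simp: batteries_def)
  \<comment> \<open>Several blocks of a port may have the same best battery, hence a sum; by
    \<open>sub01\<close> at most one of its terms is nonzero.\<close>
  define s where "s j k t = (\<Sum>b\<in>?N k. if best k b = j \<and> fst b < t \<and> t \<le> snd b then lam k b else 0)" for j k t
  have s_sum: "s j k t = (\<Sum>b | b \<in> ?N k \<and> best k b = j \<and> fst b < t \<and> t \<le> snd b. lam k b)" for j k t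
    unfolding s_def by (simp add: sum.inter_filter finN)
  define cover where "cover k t = (\<Sum>b | b \<in> ?N k \<and> fst b < t \<and> t \<le> snd b. lam k b)" for k t
  \<comment> \<open>Any two blocks containing the common period \<open>t\<close> overlap, so the
    conflict constraints apply to every pair in \<open>A\<close>.\<close>
  have sub01: "sum (lam k) A \<in> {0, 1}"
    if "k \<in> ports D" "A \<subseteq> {b \<in> ?N k. fst b < t \<and> t \<le> snd b}" for k t A
  proof (rule sum_le_one_if_pairwise)
    show "finite A" using that(2) finN[of k] by (auto intro: finite_subset)
    show "lam k b + lam k c \<le> 1" if "b \<in> A" "c \<in> A" "b \<noteq> c" for b c
    proof -
      have bc: "b \<in> ?N k" "c \<in> ?N k" "fst b < t" "t \<le> snd b" "fst c < t" "t \<le> snd c"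
        using that \<open>A \<subseteq> _\<close> by blast+
      then have "fst c < snd b" "fst b < snd c" by simp_all
      then show ?thesis using feas bc that(3) \<open>k \<in> ports D\<close> unfolding P_ylam_iff by blast
    qed
  qed (use lam01 in auto)
  \<comment> \<open>Each block belongs to exactly one battery, so summing over batteries counts
    every covering block once.\<close>
  have sum_s: "(\<Sum>j\<in>batteries D. s j k t) = cover k t" for k t
  proof -
    have "(\<Sum>j\<in>batteries D. s j k t)
        = (\<Sum>b\<in>?N k. \<Sum>j\<in>batteries D. if best k b = j \<and> fst b < t \<and> t \<le> snd b then lam k b else 0)"
      unfolding s_def by (rule sum.swap)
    also have "\<dots> = (\<Sum>b\<in>?N k. if fst b < t \<and> t \<le> snd b then lam k b else 0)"
    proof (rule sum.cong[OF refl])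
      fix b assume "b \<in> ?N k"
      have "(\<Sum>j\<in>batteries D. if best k b = j \<and> fst b < t \<and> t \<le> snd b then lam k b else 0)
          = (\<Sum>j\<in>batteries D. if j = best k b then (if fst b < t \<and> t \<le> snd b then lam k b else 0) else 0)"
        by (rule sum.cong) auto
      then show "(\<Sum>j\<in>batteries D. if best k b = j \<and> fst b < t \<and> t \<le> snd b then lam k b else 0)
          = (if fst b < t \<and> t \<le> snd b then lam k b else 0)"
        using best_battery[OF \<open>b \<in> ?N k\<close>] finB by simp
    qed
    finally show ?thesis unfolding cover_def by (simp add: sum.inter_filter finN)
  qed
  have bin: "binary_s D s" unfolding binary_s_def
  proof (intro allI)
    fix j k t
    show "if \<exists>l\<in>windows D. j \<in> window_batteries D l \<and> k \<in> ports D \<and> t \<in> window_periods D l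
          then s j k t \<in> {0, 1} else s j k t = 0"
    proof (cases "\<exists>l\<in>windows D. j \<in> window_batteries D l \<and> k \<in> ports D \<and> t \<in> window_periods D l")
      case True
      then have "s j k t \<in> {0, 1}" unfolding s_sum by (intro sub01[of k _ t]) auto
      with True show ?thesis by simp
    next
      case False
      \<comment> \<open>A block covering \<open>t\<close> gives \<open>t > 0\<close> and ends within
        the window of its battery; the index is thus admissible unless \<open>k\<close> is not a
        port, where \<open>lam\<close> vanishes.\<close>
      have "(if best k b = j \<and> fst b < t \<and> t \<le> snd b then lam k b else 0) = 0" if "b \<in> ?N k" for b
        using best(1)[OF that] False lam_port[of k b] by (force simp: window_periods_def)
      then have "s j k t = 0" unfolding s_def by (rule sum.neutral[rule_format])
      with False show ?thesis by auto
    qed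
  qed
  have starts: "(\<Sum>b | b \<in> ?N k \<and> fst b = t. lam k b) \<le> y k t"
    and stops: "(\<Sum>b | b \<in> ?N k \<and> snd b = t. lam k b) \<le> y k t"
    if "k \<in> ports D" "t \<in> periods D - {horizon D}" for k t
    using feas that unfolding P_ylam_iff by blast+
  have union_le: "sum (lam k) A \<le> sum (lam k) B + sum (lam k) C"
    if "A \<subseteq> B \<union> C" "B \<subseteq> ?N k" "C \<subseteq> ?N k" for k A B C
  proof -
    have fin: "finite B" "finite C" using that finN[of k] finite_subset by blast+
    have "sum (lam k) A \<le> sum (lam k) (B \<union> C)" using that fin lam0 by (intro sum_mono2) auto
    also have "\<dots> \<le> sum (lam k) B + sum (lam k) C"
      using fin lam0 by (subst sum.union_inter[symmetric]) (auto intro: sum_nonneg)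
    finally show ?thesis .
  qed
  have "(y, s) \<in> P_ys D" unfolding P_ys_def
  proof (clarify, intro conjI ballI)
    show "binary_y D y" using feas by (simp add: P_ylam_iff)
    show "binary_s D s" by (rule bin)
  next
    fix k t assume kt: "k \<in> ports D" "t \<in> periods D - {horizon D}"
    \<comment> \<open>A block covering \<open>t + 1\<close> either covers \<open>t\<close> already
      or starts at \<open>t\<close>.\<close>
    have "cover k (t + 1) \<le> cover k t + (\<Sum>b | b \<in> ?N k \<and> fst b = t. lam k b)"
      unfolding cover_def by (rule union_le) auto
    then show "y k t \<ge> (\<Sum>j\<in>batteries D. s j k (t + 1)) - (\<Sum>j\<in>batteries D. s j k t)"
      using starts[OF kt] by (simp add: sum_s)
  next
    fix l j k t assume a: "l \<in> windows D" "j \<in> window_batteries D l" "k \<in> ports D"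
      "t \<in> window_periods D l - {horizon D}"
    then have t: "t \<in> periods D - {horizon D}"
      using D by (force simp: valid_data_def window_periods_def periods_def)
    \<comment> \<open>A block of \<open>j\<close> covering \<open>t\<close> either covers
      \<open>t + 1\<close> too or ends at \<open>t\<close>.\<close>
    have "s j k t \<le> s j k (t + 1) + (\<Sum>b | b \<in> ?N k \<and> snd b = t. lam k b)"
      unfolding s_sum by (rule union_le) auto
    then show "y k t \<ge> s j k t - s j k (t + 1)" using stops[OF a(3) t] by simp
  next
    fix t assume "t \<in> periods D - {horizon D}"
    then show "(\<Sum>k\<in>ports D. y k t) \<le> real (switch_limit D)" using feas unfolding P_ylam_iff by blast
  next
    fix k t assume "k \<in> ports D"
    then have "cover k t \<in> {0, 1}" unfolding cover_def by (intro sub01[of k _ t]) auto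
    then show "(\<Sum>j\<in>batteries D. s j k t) \<le> 1" by (auto simp: sum_s)
  qed
  \<comment> \<open>After moving the sum over blocks outermost, each block retains only its best
    battery and its own periods, which add up to its cost.\<close>
  moreover have "battery_cost D mu s k = (\<Sum>b\<in>?N k. real_of_ereal (d_block D mu k b) * lam k b)" for k
  proof -
    let ?in = "\<lambda>b t. fst b < t \<and> t \<le> snd b"
    have "battery_cost D mu s k = (\<Sum>j\<in>batteries D. \<Sum>t\<in>periods D. \<Sum>b\<in>?N k.
        if best k b = j \<and> ?in b t then cbar D mu j k t * lam k b else 0)"
      unfolding battery_cost_def s_def by (simp add: sum_distrib_left if_distrib cong: if_cong)
    also have "\<dots> = (\<Sum>b\<in>?N k. \<Sum>j\<in>batteries D. \<Sum>t\<in>periods D.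
        if best k b = j \<and> ?in b t then cbar D mu j k t * lam k b else 0)"
      by (simp add: sum.swap[of _ "?N k"])
    also have "\<dots> = (\<Sum>b\<in>?N k. real_of_ereal (d_block D mu k b) * lam k b)"
    proof (rule sum.cong[OF refl])
      fix b assume b: "b \<in> ?N k"
      have "(\<Sum>j\<in>batteries D. \<Sum>t\<in>periods D. if best k b = j \<and> ?in b t then cbar D mu j k t * lam k b else 0)
          = (\<Sum>j\<in>batteries D. if j = best k b then \<Sum>t\<in>periods D. if ?in b t then cbar D mu j k t * lam k b else 0 else 0)"
        by (rule sum.cong) auto
      also have "\<dots> = (\<Sum>t\<in>periods D. if ?in b t then cbar D mu (best k b) k t * lam k b else 0)"
        using best_battery[OF b] finB by simp
      also have "\<dots> = (\<Sum>t = fst b + 1..snd b. cbar D mu (best k b) k t * lam k b)"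
      proof -
        have "{t \<in> periods D. ?in b t} = {fst b + 1..snd b}"
          using b by (auto simp: periods_def neg_blocks_def time_blocks_def)
        then show ?thesis by (simp add: sum.inter_filter[symmetric] periods_def)
      qed
      also have "\<dots> = real_of_ereal (d_block D mu k b) * lam k b"
        by (simp add: best(2)[OF b] sum_distrib_right)
      finally show "(\<Sum>j\<in>batteries D. \<Sum>t\<in>periods D. if best k b = j \<and> ?in b t then cbar D mu j k t * lam k b else 0)
        = real_of_ereal (d_block D mu k b) * lam k b" .
    qed
    finally show ?thesis .
  qed
  then have "obj_r D mu (y, s) = obj_tb D mu (y, lam)"
    by (simp add: obj_r_eq[OF D bin] obj_tb_def)
  ultimately show ?thesis using that by blast
qed

subsection \<open>From schedules to time blocks\<close>

text \<open>Only an inequality holds: runs of nonnegative cost are dropped, and on a negative block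
  another battery may be cheaper than the scheduled one. The same \<open>y\<close> works because it
  equals 1 at every run end point strictly between 0 and the horizon.\<close>

lemma blocks_of_schedule:
  assumes D: "valid_data D" and feas: "(y, s) \<in> P_ys D"
  obtains lam where "(y, lam) \<in> P_ylam D mu" and "obj_tb D mu (y, lam) \<le> obj_r D mu (y, s)"
proof -
  let ?N = "neg_blocks D mu"
  let ?B = "batteries D"
  define A where "A k j = {t. s j k t = 1}" for k j
  have finB: "finite ?B" using D by (simp add: valid_data_def)
  note finN = finite_neg_blocks[of D mu]
  have bin: "binary_s D s" and biny: "binary_y D y" using feas by (auto simp: P_ys_def)
  have s01: "s j k t = (if t \<in> A k j then 1 else 0)" for j k t
  proof -
    have "s j k t \<in> {0, 1}" using bin unfolding binary_s_def by (metis insertCI)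
    then show ?thesis by (auto simp: A_def)
  qed
  have A_window: "\<exists>l\<in>windows D. j \<in> window_batteries D l \<and> k \<in> ports D \<and> t \<in> window_periods D l"
    if "t \<in> A k j" for t k j
  proof (rule ccontr)
    assume "\<not> ?thesis"
    then have "s j k t = 0" using bin unfolding binary_s_def by metis
    then show False using that by (simp add: A_def)
  qed
  have A_periods: "A k j \<subseteq> periods D" for k j
  proof
    fix t assume "t \<in> A k j"
    from A_window[OF this] show "t \<in> periods D"
      using D by (force simp: valid_data_def window_periods_def periods_def)
  qed
  have A_fin: "finite (A k j)" for k j
    using A_periods by (rule finite_subset) (simp add: periods_def)
  have A_zero: "0 \<notin> A k j" for k j using A_periods[of k j] by (auto simp: periods_def)
  have A_battery: "j \<in> ?B" "k \<in> ports D" if "t \<in> A k j" for t k j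
    using A_window[OF that] by (auto simp: batteries_def)
  \<comment> \<open>Two batteries at one port in one period would exceed the capacity 1 of the
    port.\<close>
  have A_unique: "j = i" if "t \<in> A k j" "t \<in> A k i" for t k j i
  proof (rule ccontr)
    assume "j \<noteq> i"
    then have "s j k t + s i k t = sum (\<lambda>j. s j k t) {j, i}" by simp
    also have "\<dots> \<le> (\<Sum>j\<in>?B. s j k t)"
      using A_battery[OF that(1)] A_battery[OF that(2)] finB by (intro sum_mono2) (auto simp: s01)
    also have "\<dots> \<le> 1"
      using feas A_battery[OF that(1)] A_periods that(1) unfolding P_ys_def by blast
    finally show False using that by (simp add: s01)
  qed
  have run_mem: "fst b < snd b" "Suc (fst b) \<in> A k j" "snd b \<in> A k j" if "b \<in> runs (A k j)" for b k j
    using that by (auto simp: runs_def)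
  have overlap: "j = i \<and> b = c"
    if b: "b \<in> runs (A k j)" and c: "c \<in> runs (A k i)" and o: "fst c < snd b" "fst b < snd c" for b c k j i
  proof -
    \<comment> \<open>The first period after both starts lies in both runs, so the batteries agree
      by \<open>A_unique\<close> and then the runs by \<open>runs_overlap\<close>.\<close>
    let ?t = "Suc (max (fst b) (fst c))"
    have "?t \<in> {fst b<..snd b}" "?t \<in> {fst c<..snd c}"
      using run_mem(1)[OF b] run_mem(1)[OF c] o by auto
    moreover have "{fst b<..snd b} \<subseteq> A k j" "{fst c<..snd c} \<subseteq> A k i"
      using b c by (auto simp: runs_def)
    ultimately have "?t \<in> A k j" "?t \<in> A k i" by blast+
    then have "j = i" by (rule A_unique)
    then show ?thesis using runs_overlap[of "fst b" "snd b" "A k j" "fst c" "snd c"] b c o by simp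
  qed
  define R where "R k = (\<Union>j\<in>?B. runs (A k j))" for k
  define lam :: "nat \<Rightarrow> nat \<times> nat \<Rightarrow> real"
    where "lam k b = (if k \<in> ports D \<and> b \<in> ?N k \<inter> R k then 1 else 0)" for k b
  have y01: "y k t \<in> {0, 1}" for k t
    using biny unfolding binary_y_def by (metis insertCI)
  \<comment> \<open>After the last period of a run the battery is gone, and the removal constraint
    forces the switch.\<close>
  have stop: "y k (snd b) = 1"
    if run: "b \<in> runs (A k j)" and t: "snd b \<in> periods D - {horizon D}" for b k j
  proof -
    have mem: "snd b \<in> A k j" "snd b + 1 \<notin> A k j" using run by (auto simp: runs_def)
    from A_window[OF mem(1)] obtain l where "l \<in> windows D" "j \<in> window_batteries D l"
      "k \<in> ports D" "snd b \<in> window_periods D l - {horizon D}" using t by blast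
    then have "y k (snd b) \<ge> s j k (snd b) - s j k (snd b + 1)" using feas unfolding P_ys_def by blast
    then show ?thesis using mem y01[of k "snd b"] by (auto simp: s01)
  qed
  text \<open>A run starts either after an idle period or right after another battery; the switch is
    forced by constraint (i) in the first case and by (ii) in the second.\<close>
  have start: "y k (fst b) = 1"
    if run: "b \<in> runs (A k j)" and t: "fst b \<in> periods D - {horizon D}" for b k j
  proof -
    let ?t = "fst b"
    have mem: "?t \<notin> A k j" "?t + 1 \<in> A k j" using run by (auto simp: runs_def)
    note jk = A_battery[OF mem(2)]
    show ?thesis
    proof (cases "\<exists>i. ?t \<in> A k i")
      case True
      then obtain i where i: "?t \<in> A k i" by blast
      then have ni: "?t + 1 \<notin> A k i" using mem A_unique by metis
      from A_window[OF i] obtain l where "l \<in> windows D" "i \<in> window_batteries D l"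
        "k \<in> ports D" "?t \<in> window_periods D l - {horizon D}" using t by blast
      then have "y k ?t \<ge> s i k ?t - s i k (?t + 1)" using feas unfolding P_ys_def by blast
      then show ?thesis using i ni y01[of k ?t] by (auto simp: s01)
    next
      case False
      have "s j k (?t + 1) \<le> (\<Sum>j\<in>?B. s j k (?t + 1))"
        using jk finB by (intro member_le_sum) (auto simp: s01)
      moreover have "(\<Sum>j\<in>?B. s j k ?t) = 0" using False by (simp add: s01)
      moreover have "y k ?t \<ge> (\<Sum>j\<in>?B. s j k (?t + 1)) - (\<Sum>j\<in>?B. s j k ?t)"
        using feas jk t unfolding P_ys_def by blast
      ultimately show ?thesis using mem y01[of k ?t] by (auto simp: s01)
    qed
  qed
  have lam_pair: "lam k b + lam k c \<le> 1"
    if "b \<noteq> c" "fst c < snd b" "fst b < snd c" for k b c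
    using overlap[of b k _ c] that by (auto simp: lam_def R_def)
  \<comment> \<open>Used with \<open>f\<close> equal to \<open>fst\<close> and to
    \<open>snd\<close>. Blocks sharing such an end point overlap, so at most one of them is
    selected, and \<open>y\<close> is 1 whenever a run has its end point there.\<close>
  have lam_le: "(\<Sum>b | b \<in> ?N k \<and> f b = t. lam k b) \<le> y k t"
    if sw: "\<And>b j. b \<in> runs (A k j) \<Longrightarrow> f b = t \<Longrightarrow> y k t = 1"
      and ov: "\<And>b c. b \<in> time_blocks D \<Longrightarrow> c \<in> time_blocks D \<Longrightarrow> f b = f c \<Longrightarrow>
        fst c < snd b \<and> fst b < snd c" for k t f
  proof (cases "\<exists>b\<in>R k. f b = t")
    case True
    then have "y k t = 1" using sw by (auto simp: R_def)
    moreover have "(\<Sum>b | b \<in> ?N k \<and> f b = t. lam k b) \<in> {0, 1}"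
    proof (rule sum_le_one_if_pairwise)
      fix b c assume "b \<in> {b \<in> ?N k. f b = t}" "c \<in> {b \<in> ?N k. f b = t}" "b \<noteq> c"
      moreover from this have "fst c < snd b \<and> fst b < snd c"
        by (intro ov) (auto simp: neg_blocks_def)
      ultimately show "lam k b + lam k c \<le> 1" using lam_pair by blast
    qed (use finN in \<open>auto simp: lam_def\<close>)
    ultimately show ?thesis by auto
  next
    case False
    then have "(\<Sum>b | b \<in> ?N k \<and> f b = t. lam k b) = 0"
      by (intro sum.neutral) (auto simp: lam_def)
    then show ?thesis using y01[of k t] by auto
  qed
  have "(y, lam) \<in> P_ylam D mu" unfolding P_ylam_iff
  proof (intro conjI ballI impI)
    show "binary_y D y" by (rule biny)
    show "binary_lam D mu lam" by (auto simp: binary_lam_def lam_def)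
  next
    fix k and b c :: "nat \<times> nat" assume "b \<noteq> c \<and> fst c < snd b \<and> fst b < snd c"
    then show "lam k b + lam k c \<le> 1" using lam_pair by blast
  next
    fix k t assume "t \<in> periods D - {horizon D}"
    then show "(\<Sum>b | b \<in> ?N k \<and> fst b = t. lam k b) \<le> y k t"
      by (intro lam_le) (use start in \<open>auto simp: time_blocks_def\<close>)
  next
    fix k t assume "t \<in> periods D - {horizon D}"
    then show "(\<Sum>b | b \<in> ?N k \<and> snd b = t. lam k b) \<le> y k t"
      by (intro lam_le) (use stop in \<open>auto simp: time_blocks_def\<close>)
  next
    fix t assume "t \<in> periods D - {horizon D}"
    then show "(\<Sum>k\<in>ports D. y k t) \<le> real (switch_limit D)" using feas unfolding P_ys_def by blast
  qed
  moreover have "(\<Sum>b\<in>?N k. real_of_ereal (d_block D mu k b) * lam k b) \<le> battery_cost D mu s k"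
    if k: "k \<in> ports D" for k
  proof -
    define d where "d b = real_of_ereal (d_block D mu k b)" for b
    let ?c = "\<lambda>j b. \<Sum>t = fst b + 1..snd b. cbar D mu j k t"
    \<comment> \<open>On a negative block the minimum is at most the cost of the scheduled battery.
      On any other block that cost is at least a nonnegative minimum, so replacing it by 0 does not
      increase the total.\<close>
    have le: "(if b \<in> ?N k then d b else 0) \<le> ?c j b" if b: "b \<in> runs (A k j)" for j b
    proof -
      from A_window[OF run_mem(3)[OF b]] obtain l where l: "l \<in> windows D" "j \<in> window_batteries D l"
        "snd b \<in> window_periods D l" by blast
      then have dle: "d_block D mu k b \<le> ereal (?c j b)"
        using d_block_le[OF D, of l j "snd b" mu k "fst b"] by (simp add: window_periods_def)
      have tb: "b \<in> time_blocks D"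
        using run_mem[OF b] A_periods[of k j] by (cases b) (auto simp: time_blocks_def periods_def)
      show ?thesis
      proof (cases "b \<in> ?N k")
        case True
        then have "d_block D mu k b = ereal (d b)"
          by (auto simp: d_def neg_blocks_def d_block_def split: if_splits)
        then show ?thesis using True dle by simp
      next
        case False
        then have "0 \<le> d_block D mu k b" using tb by (simp add: neg_blocks_def not_less)
        then have "0 \<le> ereal (?c j b)" using dle by (rule order_trans)
        then show ?thesis using False by simp
      qed
    qed
    have "(\<Sum>b\<in>?N k. d b * lam k b) = (\<Sum>b\<in>?N k. if b \<in> R k then d b else 0)"
      using k by (intro sum.cong) (auto simp: lam_def)
    also have "\<dots> = sum d (?N k \<inter> R k)" by (simp add: sum.inter_restrict finN)
    also have "\<dots> = (\<Sum>b\<in>R k. if b \<in> ?N k then d b else 0)"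
      using finB finite_runs[OF A_fin] by (subst Int_commute, subst sum.inter_restrict) (auto simp: R_def)
    also have "\<dots> = (\<Sum>j\<in>?B. \<Sum>b\<in>runs (A k j). if b \<in> ?N k then d b else 0)"
      unfolding R_def
    proof (rule sum.UNION_disjoint)
      \<comment> \<open>A common run would put its last period into the sets of two different
        batteries.\<close>
      show "\<forall>j\<in>?B. \<forall>i\<in>?B. j \<noteq> i \<longrightarrow> runs (A k j) \<inter> runs (A k i) = {}"
        using run_mem(3) A_unique by blast
    qed (use finB finite_runs[OF A_fin] in auto)
    also have "\<dots> \<le> (\<Sum>j\<in>?B. \<Sum>b\<in>runs (A k j). ?c j b)"
      by (intro sum_mono le)
    also have "\<dots> = (\<Sum>j\<in>?B. sum (cbar D mu j k) (A k j))"
      by (simp add: sum_runs[OF A_fin A_zero])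
    also have "\<dots> = battery_cost D mu s k" unfolding battery_cost_def
    proof (rule sum.cong[OF refl])
      fix j
      have "(\<Sum>t\<in>periods D. cbar D mu j k t * s j k t) = sum (cbar D mu j k) (periods D \<inter> A k j)"
        by (subst sum.inter_restrict) (auto simp: s01 periods_def intro: sum.cong)
      also have "periods D \<inter> A k j = A k j" using A_periods by blast
      finally show "sum (cbar D mu j k) (A k j) = (\<Sum>t\<in>periods D. cbar D mu j k t * s j k t)" by simp
    qed
    finally show ?thesis by (simp add: d_def)
  qed
  then have "obj_tb D mu (y, lam) \<le> obj_r D mu (y, s)"
    by (simp add: obj_r_eq[OF D bin] obj_tb_def sum_mono)
  ultimately show ?thesis using that by blast
qed

subsection \<open>Existence of an optimal block selection\<close>

text \<open>Binary functions that vanish off their index sets are determined by where they equal 1,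
  that is, by subsets of finite sets; \<open>?f\<close> recovers the functions from these
  supports.\<close>

lemma finite_P_ylam: "finite (P_ylam D mu)"
proof -
  let ?f = "\<lambda>(Y, L). (\<lambda>k t. if (k, t) \<in> Y then 1 else 0 :: real, \<lambda>k b. if (k, b) \<in> L then 1 else 0 :: real)"
  let ?S = "Pow (ports D \<times> periods D) \<times> Pow (ports D \<times> time_blocks D)"
  have "finite ?S" using finite_time_blocks[of D] by (auto simp: ports_def periods_def)
  moreover have "P_ylam D mu \<subseteq> ?f ` ?S"
  proof (intro subsetI)
    fix x assume "x \<in> P_ylam D mu"
    then obtain y lam where x: "x = (y, lam)" and y: "binary_y D y" and lam: "binary_lam D mu lam"
      by (auto simp: P_ylam_def)
    have "x = ?f ({(k, t). y k t = 1}, {(k, b). lam k b = 1})"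
      using y lam unfolding x binary_y_def binary_lam_def
      by (auto intro!: ext) (metis insertE singletonD)+
    moreover have "({(k, t). y k t = 1}, {(k, b). lam k b = 1}) \<in> ?S"
    proof -
      have "k \<in> ports D \<and> t \<in> periods D" if "y k t = 1" for k t
        using y that unfolding binary_y_def by (metis DiffD1 zero_neq_one)
      moreover have "k \<in> ports D \<and> b \<in> time_blocks D" if "lam k b = 1" for k b
      proof -
        have "k \<in> ports D \<and> b \<in> neg_blocks D mu k"
          using lam that unfolding binary_lam_def by (metis zero_neq_one)
        then show ?thesis by (simp add: neg_blocks_def)
      qed
      ultimately show ?thesis by auto
    qed
    ultimately show "x \<in> ?f ` ?S" by (rule image_eqI)
  qed
  ultimately show ?thesis by (meson finite_imageI finite_subset)
qed

text \<open>Never switching and selecting no block is feasible, so a finite nonempty set is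
  minimized over.\<close>

lemma ex_optimal_tb: "\<exists>x. optimal_tb D mu x"
proof -
  have "((\<lambda>k t. 0), (\<lambda>k b. 0)) \<in> P_ylam D mu"
    by (auto simp: P_ylam_iff binary_y_def binary_lam_def)
  then show ?thesis unfolding optimal_tb_def
    using ex_is_arg_min_if_finite[OF finite_P_ylam, of D mu "obj_tb D mu"] by auto
qed

theorem proposition4p5:
  fixes D :: "'b charging_data"
    and mu :: "'b \<Rightarrow> nat \<Rightarrow> nat \<Rightarrow> real"
  assumes "valid_data D"
  shows "(\<exists>y lam. (y, lam) \<in> P_ylam D mu \<and> optimal_tb D mu (y, lam)) \<and>
         (\<forall>y lam. optimal_tb D mu (y, lam) \<longrightarrow>
            (\<exists>s. (y, s) \<in> P_ys D \<and> optimal_r D mu (y, s)))"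
proof (intro conjI allI impI)
  obtain y lam where "optimal_tb D mu (y, lam)" using ex_optimal_tb by (metis surj_pair)
  then show "\<exists>y lam. (y, lam) \<in> P_ylam D mu \<and> optimal_tb D mu (y, lam)"
    by (auto simp: optimal_tb_def is_arg_min_def)
next
  fix y lam assume opt: "optimal_tb D mu (y, lam)"
  then have "(y, lam) \<in> P_ylam D mu" by (simp add: optimal_tb_def is_arg_min_def)
  then obtain s where s: "(y, s) \<in> P_ys D" "obj_r D mu (y, s) = obj_tb D mu (y, lam)"
    by (rule schedule_of_blocks[OF assms])
  \<comment> \<open>A cheaper schedule \<open>x\<close> would yield a block selection of cost at
    most that of \<open>x\<close>, hence below the optimum attained by
    \<open>(y, lam)\<close>.\<close>
  have "\<not> obj_r D mu x < obj_r D mu (y, s)" if "x \<in> P_ys D" for x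
  proof -
    obtain y' s' where x: "x = (y', s')" by (cases x)
    with that obtain lam' where "(y', lam') \<in> P_ylam D mu"
      "obj_tb D mu (y', lam') \<le> obj_r D mu x"
      using blocks_of_schedule[OF assms] by metis
    then show ?thesis using opt s(2) by (force simp: optimal_tb_def is_arg_min_def)
  qed
  then show "\<exists>s. (y, s) \<in> P_ys D \<and> optimal_r D mu (y, s)"
    using s(1) by (auto simp: optimal_r_def is_arg_min_def)
qed

end
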